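(* Let $\Lambda$ be a compact metric space and let $f:\Lambda\to\Lambda$ be an expansive homeomorphism which satisfies the periodic gluing orbit property. If $h:\Lambda\to\Lambda$ is a homeomorphism with $h\circ f=f\circ h$ that preserves the periodic orbits of $f$, then $h=f^k$ for some $k\in\mathbb Z$.
   Context: Let $d$ be the metric on $\Lambda$. A homeomorphism $f$ of $\Lambda$ is expansive if there exists $\varepsilon>0$ such that for any distinct $x,y\in\Lambda$ there is $n\in\mathbb Z$ with $d(f^n(x),f^n(y))>\varepsilon$. $f$ has the periodic gluing orbit property if for every $\varepsilon>0$ there exists $K=K(\varepsilon)>0$ such that for any points $x_0,x_1,\dots,x_m\in\Lambda$ and positive integers $n_0,n_1,\dots,n_m\ge 1$ there are positive integers $p_0,p_1,\dots,p_m\le K(\varepsilon)$ and $x\in\Lambda$ such that: $d(f^{l}(x),f^{l}(x_0))<\varepsilon$ for all $1\le l\le n_0$; $d\big(f^{\,l+\sum_{j=0}^{i-1}(p_j+n_j)}(x),f^{l}(x_i)\big)<\varepsilon$ for all $1\le l\le n_i$ and $1\le i\le m$; and $f^{\sum_{j=0}^{m}(p_j+n_j)}(x)=x$. $\mathrm{Per}(f)$ is the set of periodic points of $f$ and $\mathcal O_f(x)=\{f^n(x):n\in\mathbb Z\}$. A homeomorphism $h$ preserves the periodic orbits of $f$ if $h(\mathcal O_f(x))=\mathcal O_f(x)$ for every $x\in\mathrm{Per}(f)$. *)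

theory Defs
  imports "HOL-Analysis.Analysis"
begin

(* The space is a subset S of a metric-space type, with the restricted metric.  Self-maps of S are
   functions on the whole type whose values outside S are irrelevant; hence the inverse of f
   is taken relative to S.  The definitions are meant for f a bijection of S. *)

definition int_iterate :: "'a set \<Rightarrow> ('a \<Rightarrow> 'a) \<Rightarrow> int \<Rightarrow> 'a \<Rightarrow> 'a" where
  "int_iterate S f n = (if n \<ge> 0 then f ^^ nat n else (inv_into S f) ^^ nat (- n))"

definition expansive_on :: "'a::metric_space set \<Rightarrow> ('a \<Rightarrow> 'a) \<Rightarrow> bool" where
  "expansive_on S f \<longleftrightarrow>
    (\<exists>\<epsilon>>0. \<forall>x\<in>S. \<forall>y\<in>S. x \<noteq> y \<longrightarrow>
      (\<exists>n::int. dist (int_iterate S f n x) (int_iterate S f n y) > \<epsilon>))"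

(* In the shadowing clause the index i = 0 has an empty sum, so that it reads
   dist (f^l z) (f^l (x 0)) < \<epsilon> for 1 \<le> l \<le> n 0. *)
definition periodic_gluing_orbit_on :: "'a::metric_space set \<Rightarrow> ('a \<Rightarrow> 'a) \<Rightarrow> bool" where
  "periodic_gluing_orbit_on S f \<longleftrightarrow>
    (\<forall>\<epsilon>>0. \<exists>K::nat. K > 0 \<and>
      (\<forall>(m::nat) (x :: nat \<Rightarrow> 'a) (n :: nat \<Rightarrow> nat).
        (\<forall>i\<le>m. x i \<in> S \<and> n i \<ge> 1) \<longrightarrow>
        (\<exists>(p :: nat \<Rightarrow> nat) z. z \<in> S \<and>
          (\<forall>i\<le>m. 1 \<le> p i \<and> p i \<le> K) \<and>
          (\<forall>i\<le>m. \<forall>l\<in>{1..n i}.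
            dist ((f ^^ (l + (\<Sum>j<i. p j + n j))) z) ((f ^^ l) (x i)) < \<epsilon>) \<and>
          (f ^^ (\<Sum>j\<le>m. p j + n j)) z = z)))"

definition periodic_points :: "'a set \<Rightarrow> ('a \<Rightarrow> 'a) \<Rightarrow> 'a set" where
  "periodic_points S f = {x \<in> S. \<exists>n::nat. n \<ge> 1 \<and> (f ^^ n) x = x}"

definition int_orbit :: "'a set \<Rightarrow> ('a \<Rightarrow> 'a) \<Rightarrow> 'a \<Rightarrow> 'a set" where
  "int_orbit S f x = {int_iterate S f n x |n::int. True}"

definition preserves_periodic_orbits :: "'a set \<Rightarrow> ('a \<Rightarrow> 'a) \<Rightarrow> ('a \<Rightarrow> 'a) \<Rightarrow> bool" where
  "preserves_periodic_orbits S f h \<longleftrightarrow>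
    (\<forall>x \<in> periodic_points S f. h ` int_orbit S f x = int_orbit S f x)"

end

theory Submission
  imports Defs
begin

text \<open>
  Suppose that there are periodic points \<open>P\<close> and \<open>Q\<close> with different orbits.  The orbits are finite
  and disjoint, hence a positive distance apart.  Let \<open>z\<close> be a periodic point of period \<open>N\<close> whose
  cyclic itinerary contains two blocks of the same length \<open>L\<close>, one shadowing \<open>P\<close> and the next,
  after a gap \<open>p\<close>, shadowing \<open>Q\<close>.  Since \<open>h\<close> preserves the orbit of \<open>z\<close>, it acts on it as a rotation
  by some \<open>c\<close> modulo \<open>N\<close>.  It also preserves the orbits of \<open>P\<close> and \<open>Q\<close> and is uniformly
  continuous, so the rotation cannot carry a time of the \<open>P\<close>-block to a time of the \<open>Q\<close>-block or
  conversely.  If the two blocks fill most of the itinerary, this forces \<open>c\<close> to lie within \<open>p\<close> of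
  \<open>0\<close> modulo \<open>N\<close> (lemmas \<open>cyclic_shift_bound\<close> and \<open>glued_orbit_shift\<close>).  The gap is at most the
  gluing constant \<open>K\<close>, which does not depend on what is glued.

  The rest of the itinerary is thus free to test all of the finitely many candidates for \<open>h\<close>.
  A candidate is a relation \<open>f^a h = f^b\<close> with \<open>a, b \<le> K\<close>.  If it fails somewhere,
  expansiveness and commutation with \<open>f\<close> make it fail at some point by more than the
  expansiveness constant, which was fixed before \<open>K\<close> (lemma \<open>expansive_commuting_far\<close>).  If
  all candidates failed, one could append to the two blocks a window shadowing a failure of each;
  the relation that holds on the orbit of \<open>z\<close> would then contradict its own window
  (lemma \<open>two_orbits_funpow_eq\<close>).

  If there is only one periodic orbit, it is the whole space because periodic points are dense, and
  a map commuting with \<open>f\<close> is determined by its value at one point.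
\<close>

section \<open>Integer iterates and periodic orbits\<close>

lemma funpow_in:
  assumes "f ` S \<subseteq> S" and "x \<in> S"
  shows "(f ^^ n) x \<in> S"
  using assms by (induction n) auto

lemma funpow_commute_on:
  assumes "f ` S \<subseteq> S" and "\<And>x. x \<in> S \<Longrightarrow> u (f x) = f (u x)" and "x \<in> S"
  shows "u ((f ^^ n) x) = (f ^^ n) (u x)"
  by (induction n) (use assms funpow_in in \<open>auto simp: funpow_in\<close>)

lemma inv_into_in:
  assumes "bij_betw f S S"
  shows "inv_into S f ` S \<subseteq> S"
  using bij_betw_inv_into[OF assms] by (simp add: bij_betw_def)

lemma inv_into_commute_on:
  assumes f: "bij_betw f S S" and u: "u ` S \<subseteq> S"
    and comm: "\<And>x. x \<in> S \<Longrightarrow> u (f x) = f (u x)" and x: "x \<in> S"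
  shows "u (inv_into S f x) = inv_into S f (u x)"
proof -
  let ?y = "inv_into S f x"
  have y: "?y \<in> S" using inv_into_in[OF f] x by blast
  have "f ?y = x" using f x by (simp add: bij_betw_inv_into_right)
  then have "f (u ?y) = u x" using comm[OF y] by simp
  moreover have "u ?y \<in> S" using u y by blast
  ultimately show ?thesis using bij_betw_inv_into_left[OF f] by metis
qed

lemma int_iterate_in:
  assumes "bij_betw f S S" and "x \<in> S"
  shows "int_iterate S f n x \<in> S"
  using assms funpow_in[OF _ assms(2)] inv_into_in[OF assms(1)]
  by (auto simp: int_iterate_def bij_betw_def)

lemma int_iterate_commute_on:
  assumes f: "bij_betw f S S" and u: "u ` S \<subseteq> S"
    and comm: "\<And>x. x \<in> S \<Longrightarrow> u (f x) = f (u x)" and x: "x \<in> S"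
  shows "u (int_iterate S f n x) = int_iterate S f n (u x)"
  using funpow_commute_on[of f S u, OF _ comm x]
    funpow_commute_on[of "inv_into S f" S u, OF inv_into_in[OF f]
      inv_into_commute_on[OF f u comm] x] f
  by (auto simp: int_iterate_def bij_betw_def)

text \<open>The counting arguments below use forward iterates; this passes to negative exponents, where
  \<open>int_iterate\<close> iterates the inverse.\<close>

lemma eq_int_iterate_of_funpow_eq:
  assumes f: "bij_betw f S S" and x: "x \<in> S" and y: "y \<in> S"
    and eq: "(f ^^ a) y = (f ^^ b) x"
  shows "y = int_iterate S f (int b - int a) x"
proof (cases "a \<le> b")
  case True
  have inj: "inj_on (f ^^ a) S" using bij_betw_funpow[OF f] by (auto simp: bij_betw_def)
  have "(f ^^ a) y = (f ^^ a) ((f ^^ (b - a)) x)"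
    using eq True by (metis comp_apply funpow_add le_add_diff_inverse)
  moreover have "(f ^^ (b - a)) x \<in> S" using f x by (simp add: bij_betw_def funpow_in)
  ultimately have "y = (f ^^ (b - a)) x" using inj y by (metis inj_onD)
  then show ?thesis using True by (simp add: int_iterate_def nat_diff_distrib')
next
  case False
  have inj: "inj_on (f ^^ b) S" using bij_betw_funpow[OF f] by (auto simp: bij_betw_def)
  have "(f ^^ b) ((f ^^ (a - b)) y) = (f ^^ b) x"
    using eq False by (metis comp_apply funpow_add le_add_diff_inverse nat_le_linear)
  moreover have "(f ^^ (a - b)) y \<in> S" using f y by (simp add: bij_betw_def funpow_in)
  ultimately have x_eq: "x = (f ^^ (a - b)) y" using inj x by (metis inj_onD)
  have inv: "(inv_into S f ^^ n) ((f ^^ n) y) = y" for n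
  proof (induction n)
    case (Suc n)
    have "(f ^^ n) y \<in> S" using f y by (simp add: bij_betw_def funpow_in)
    then have "inv_into S f (f ((f ^^ n) y)) = (f ^^ n) y" using bij_betw_inv_into_left[OF f] by blast
    then show ?case using Suc by (simp add: funpow_swap1)
  qed simp
  have "nat (- (int b - int a)) = a - b" using False by simp
  then show ?thesis using False inv[of "a - b"] x_eq by (simp add: int_iterate_def)
qed

lemma funpow_in_int_orbit: "(f ^^ l) x \<in> int_orbit S f x"
proof -
  have "(f ^^ l) x = int_iterate S f (int l) x" by (simp add: int_iterate_def)
  then show ?thesis unfolding int_orbit_def by blast
qed

text \<open>One period of forward iterates is also closed under the inverse: every point of it can be
  written with exponent \<open>l + N > 0\<close>, and one factor of \<open>f\<close> cancelled.\<close>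

lemma int_orbit_periodic:
  assumes f: "bij_betw f S S" and x: "x \<in> S" and N: "N \<ge> 1" and per: "(f ^^ N) x = x"
  shows "int_orbit S f x = (\<lambda>l. (f ^^ l) x) ` {..<N}"
proof
  let ?O = "(\<lambda>l. (f ^^ l) x) ` {..<N}"
  have all: "(f ^^ l) x \<in> ?O" for l
  proof -
    have "(f ^^ l) x = (f ^^ (l mod N)) x" using funpow_mod_eq[OF per] by simp
    moreover have "l mod N < N" using N by simp
    ultimately show ?thesis by blast
  qed
  have inv: "inv_into S f ` ?O \<subseteq> ?O"
  proof (rule image_subsetI)
    fix y assume "y \<in> ?O"
    then obtain l where l: "y = (f ^^ l) x" by blast
    have "y = (f ^^ (l + N)) x" using l per by (simp add: funpow_add)
    also have "\<dots> = f ((f ^^ (l + N - 1)) x)"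
      using N by (metis Suc_pred' add_gr_0 comp_apply funpow.simps(2) less_eq_Suc_le One_nat_def)
    finally have "y = f ((f ^^ (l + N - 1)) x)" .
    moreover have "(f ^^ (l + N - 1)) x \<in> S" using f x by (simp add: bij_betw_def funpow_in)
    ultimately have "inv_into S f y = (f ^^ (l + N - 1)) x"
      using bij_betw_inv_into_left[OF f] by metis
    then show "inv_into S f y \<in> ?O" using all by simp
  qed
  have "x \<in> ?O" using all[of 0] by simp
  then show "int_orbit S f x \<subseteq> ?O"
    using all funpow_in[OF inv] by (auto simp: int_orbit_def int_iterate_def)
  show "?O \<subseteq> int_orbit S f x" by (intro image_subsetI funpow_in_int_orbit)
qed

lemma finite_int_orbit_periodic:
  assumes "bij_betw f S S" and "x \<in> periodic_points S f"
  shows "finite (int_orbit S f x)"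
  using assms int_orbit_periodic[OF assms(1)] by (fastforce simp: periodic_points_def)

lemma periodic_int_orbit_disjoint:
  assumes f: "bij_betw f S S" and x: "x \<in> periodic_points S f" and y: "y \<in> periodic_points S f"
    and notin: "y \<notin> int_orbit S f x"
  shows "int_orbit S f x \<inter> int_orbit S f y = {}"
proof (rule ccontr)
  assume "\<not> ?thesis"
  then obtain w where w: "w \<in> int_orbit S f x" "w \<in> int_orbit S f y" by blast
  obtain N where N: "N \<ge> 1" "(f ^^ N) x = x" and xS: "x \<in> S" using x by (auto simp: periodic_points_def)
  obtain M where M: "M \<ge> 1" "(f ^^ M) y = y" and yS: "y \<in> S" using y by (auto simp: periodic_points_def)
  obtain a where a: "w = (f ^^ a) x" using w(1) int_orbit_periodic[OF f xS N] by blast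
  obtain b where b: "b < M" "w = (f ^^ b) y" using w(2) int_orbit_periodic[OF f yS M] by blast
  have "y = (f ^^ (M - b + b)) y" using M b by simp
  also have "\<dots> = (f ^^ (M - b)) w" using b by (metis comp_apply funpow_add)
  also have "\<dots> = (f ^^ (M - b + a)) x" using a by (simp add: funpow_add)
  finally show False using notin funpow_in_int_orbit by metis
qed

lemma preserves_periodic_orbitsD:
  assumes "preserves_periodic_orbits S f h" and "x \<in> periodic_points S f"
  shows "h ((f ^^ l) x) \<in> int_orbit S f x"
  using assms funpow_in_int_orbit[of l f x S] unfolding preserves_periodic_orbits_def by blast

section \<open>Expansiveness and density of periodic points\<close>

text \<open>Expansiveness separates \<open>u x\<close> and \<open>v x\<close> after some number of iterates; as \<open>u\<close> and \<open>v\<close> commute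
  with \<open>f\<close>, the iterates can be moved to the argument.  The witness is written as \<open>f w\<close> because
  gluing controls an orbit only from time \<open>1\<close> on.\<close>

lemma expansive_commuting_far:
  assumes f: "bij_betw f S S"
    and exp: "\<forall>x\<in>S. \<forall>y\<in>S. x \<noteq> y \<longrightarrow>
      (\<exists>n::int. dist (int_iterate S f n x) (int_iterate S f n y) > e)"
    and u: "u ` S \<subseteq> S" "\<And>x. x \<in> S \<Longrightarrow> u (f x) = f (u x)"
    and v: "v ` S \<subseteq> S" "\<And>x. x \<in> S \<Longrightarrow> v (f x) = f (v x)"
    and ne: "\<exists>x\<in>S. u x \<noteq> v x"
  shows "\<exists>w\<in>S. dist (u (f w)) (v (f w)) > e"
proof -
  obtain x where x: "x \<in> S" "u x \<noteq> v x" using ne by blast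
  have "u x \<in> S" "v x \<in> S" using u(1) v(1) x by auto
  then obtain n where n: "dist (int_iterate S f n (u x)) (int_iterate S f n (v x)) > e"
    using exp x(2) by blast
  have "int_iterate S f n x \<in> f ` S" using int_iterate_in[OF f x(1)] f by (simp add: bij_betw_def)
  then obtain w where w: "w \<in> S" "f w = int_iterate S f n x" by force
  then show ?thesis
    using n int_iterate_commute_on[OF f u x(1)] int_iterate_commute_on[OF f v x(1)] by metis
qed

text \<open>Gluing a single block of length \<open>1\<close> that starts at a preimage of \<open>y\<close> gives a periodic
  point whose first iterate is near \<open>y\<close>.\<close>

lemma periodic_points_dense:
  assumes f: "bij_betw f S S" and glue: "periodic_gluing_orbit_on S f" and y: "y \<in> S"
    and \<epsilon>: "\<epsilon> > 0"
  shows "\<exists>x\<in>periodic_points S f. dist x y < \<epsilon>"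
proof -
  have "y \<in> f ` S" using f y by (simp add: bij_betw_def)
  then obtain w where w: "w \<in> S" "f w = y" by blast
  obtain K where K: "\<forall>(m::nat) (x :: nat \<Rightarrow> 'a) (n :: nat \<Rightarrow> nat).
        (\<forall>i\<le>m. x i \<in> S \<and> n i \<ge> 1) \<longrightarrow>
        (\<exists>(p :: nat \<Rightarrow> nat) z. z \<in> S \<and>
          (\<forall>i\<le>m. 1 \<le> p i \<and> p i \<le> K) \<and>
          (\<forall>i\<le>m. \<forall>l\<in>{1..n i}.
            dist ((f ^^ (l + (\<Sum>j<i. p j + n j))) z) ((f ^^ l) (x i)) < \<epsilon>) \<and>
          (f ^^ (\<Sum>j\<le>m. p j + n j)) z = z)"
    using glue \<epsilon> unfolding periodic_gluing_orbit_on_def by blast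
  obtain p z where z: "z \<in> S" "dist ((f ^^ 1) z) ((f ^^ 1) w) < \<epsilon>"
    "(f ^^ (p 0 + 1)) z = z"
    using K[rule_format, of 0 "\<lambda>_. w" "\<lambda>_. 1"] w(1) by auto
  have "(f ^^ (p 0 + 1)) (f z) = f z" using z(3) by (simp add: funpow_swap1)
  then have "f z \<in> periodic_points S f"
    using z(1) f unfolding periodic_points_def bij_betw_def by (auto intro!: exI[of _ "p 0 + 1"])
  then show ?thesis using z(2) w(2) by auto
qed

lemma single_periodic_orbit:
  assumes f: "bij_betw f S S" and glue: "periodic_gluing_orbit_on S f"
    and x: "x \<in> periodic_points S f" and single: "periodic_points S f \<subseteq> int_orbit S f x"
  shows "S \<subseteq> int_orbit S f x"
proof
  fix y assume y: "y \<in> S"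
  have "y \<in> closure (int_orbit S f x)"
    using periodic_points_dense[OF f glue y] single unfolding closure_approachable by blast
  then show "y \<in> int_orbit S f x"
    using finite_imp_closed[OF finite_int_orbit_periodic[OF f x]] by simp
qed

section \<open>The shift on a glued periodic orbit\<close>

text \<open>On a cycle of length \<open>N\<close>, the first block consists of the times \<open>1, \<dots>, L\<close> and the second of
  \<open>L + p + 1, \<dots>, 2 * L + p\<close>.  A forward shift by an amount strictly between \<open>p\<close> and \<open>2 * L + p\<close>
  makes the first block meet the second, so \<open>c\<close> and \<open>N - c\<close> both avoid this range.  A shift of at
  least \<open>2 * L + p\<close> leaves at most \<open>L\<close> in the backward direction, which is excluded too unless it
  is at most \<open>p\<close>.\<close>

lemma cyclic_shift_bound:
  fixes c N L p :: nat
  assumes c: "c < N" and N: "2 * L + p \<le> N" "N \<le> 3 * L + p" and L: "L > 0"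
    and fwd: "\<And>l. \<lbrakk>1 \<le> l; l \<le> L; L + p < l + c; l + c \<le> 2 * L + p\<rbrakk> \<Longrightarrow> False"
    and bwd: "\<And>l. \<lbrakk>1 \<le> l; l \<le> L; L + p < l + (N - c); l + (N - c) \<le> 2 * L + p\<rbrakk> \<Longrightarrow> False"
  shows "c \<le> p \<or> N - c \<le> p"
proof (rule ccontr)
  assume "\<not> ?thesis"
  then have *: "p < c" "p < N - c" by auto
  consider "c \<le> L + p" | "L + p < c" "c < 2 * L + p" | "2 * L + p \<le> c" by linarith
  then show False
  proof cases
    case 1 then show False using fwd[of L] * L by simp
  next
    case 2 then show False using fwd[of 1] L by simp
  next
    case 3
    then have "N - c \<le> L" using N by simp
    moreover have "L + p < L + (N - c)" using * by linarith
    moreover have "L + (N - c) \<le> 2 * L + p" using \<open>N - c \<le> L\<close> by linarith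
    ultimately show False using bwd[of L] L by linarith
  qed
qed

text \<open>If \<open>h z = f^c z\<close>, then \<open>h\<close> adds \<open>c\<close> to every time along the orbit of \<open>z\<close>, and it must not move a
  time of one block into the other, as the two blocks stay near different orbits that \<open>h\<close>
  preserves.  A pair of exponents covers both directions of the resulting small shift:
  the proof takes \<open>a = 0\<close> for a forward and \<open>b = 0\<close> for a backward shift.\<close>

lemma glued_orbit_shift:
  fixes S :: "'a::metric_space set"
  assumes f: "bij_betw f S S" and comm: "\<And>x. x \<in> S \<Longrightarrow> h (f x) = f (h x)"
    and pres: "preserves_periodic_orbits S f h"
    and P: "P \<in> periodic_points S f" and Q: "Q \<in> periodic_points S f"
    and sep: "\<And>a b. \<lbrakk>a \<in> int_orbit S f P; b \<in> int_orbit S f Q\<rbrakk> \<Longrightarrow> dist a b \<ge> 2 * \<rho>"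
    and unif: "\<And>x y. \<lbrakk>x \<in> S; y \<in> S; dist x y < \<delta>\<rbrakk> \<Longrightarrow> dist (h x) (h y) < \<rho>" and le: "\<delta> \<le> \<rho>"
    and z: "z \<in> S" "(f ^^ N) z = z"
    and zP: "\<And>l. \<lbrakk>1 \<le> l; l \<le> L\<rbrakk> \<Longrightarrow> dist ((f ^^ l) z) ((f ^^ l) P) < \<delta>"
    and zQ: "\<And>l. \<lbrakk>1 \<le> l; l \<le> L\<rbrakk> \<Longrightarrow> dist ((f ^^ (l + (p + L))) z) ((f ^^ l) Q) < \<delta>"
    and N: "2 * L + p \<le> N" "N \<le> 3 * L + p" and L: "L > 0"
  shows "\<exists>a\<le>p. \<exists>b\<le>p. (f ^^ a) (h z) = (f ^^ b) z"
proof -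
  have fS: "f ` S \<subseteq> S" using f by (simp add: bij_betw_def)
  have PS: "P \<in> S" and QS: "Q \<in> S" using P Q by (auto simp: periodic_points_def)
  have "z \<in> periodic_points S f" using z N L unfolding periodic_points_def by (auto intro!: exI[of _ N])
  then have "h z \<in> int_orbit S f z" using preserves_periodic_orbitsD[OF pres, of z 0] by simp
  then obtain c where c: "c < N" "h z = (f ^^ c) z"
    using int_orbit_periodic[OF f z(1) _ z(2)] N L by fastforce
  have hz: "h ((f ^^ l) z) = (f ^^ (l + c)) z" for l
    using funpow_commute_on[of f S h, OF fS comm z(1)] c by (simp add: funpow_add)
  have PQ: "h ((f ^^ l) z) \<noteq> (f ^^ s) z \<and> h ((f ^^ s) z) \<noteq> (f ^^ l) z"
    if l: "1 \<le> l" "l \<le> L" and s: "L + p < s" "s \<le> 2 * L + p" for l s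
  proof -
    define t where "t = s - (p + L)"
    have t: "1 \<le> t" "t \<le> L" "s = t + (p + L)" using s by (auto simp: t_def)
    have dP: "dist ((f ^^ l) z) ((f ^^ l) P) < \<delta>" using zP l by blast
    have dQ: "dist ((f ^^ s) z) ((f ^^ t) Q) < \<delta>" using zQ t by simp
    have hP: "dist (h ((f ^^ l) z)) (h ((f ^^ l) P)) < \<rho>"
      using unif dP funpow_in[OF fS] z(1) PS by blast
    have hQ: "dist (h ((f ^^ s) z)) (h ((f ^^ t) Q)) < \<rho>"
      using unif dQ funpow_in[OF fS] z(1) QS by blast
    have "dist (h ((f ^^ l) P)) ((f ^^ t) Q) \<ge> 2 * \<rho>"
      by (rule sep[OF preserves_periodic_orbitsD[OF pres P] funpow_in_int_orbit])
    moreover have "dist ((f ^^ l) P) (h ((f ^^ t) Q)) \<ge> 2 * \<rho>"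
      by (rule sep[OF funpow_in_int_orbit preserves_periodic_orbitsD[OF pres Q]])
    ultimately show ?thesis using dP dQ hP hQ le
        dist_triangle_less_add[of "h ((f ^^ l) P)" "(f ^^ s) z" \<rho> "(f ^^ t) Q" \<rho>]
        dist_triangle_less_add[of "(f ^^ l) P" "(f ^^ l) z" \<rho> "h ((f ^^ t) Q)" \<rho>]
      by (auto simp: dist_commute)
  qed
  have "c \<le> p \<or> N - c \<le> p"
  proof (rule cyclic_shift_bound[OF c(1) N L])
    fix l assume l: "1 \<le> l" "l \<le> L" "L + p < l + c" "l + c \<le> 2 * L + p"
    then show False using PQ[of l "l + c"] hz[of l] by simp
  next
    fix l assume l: "1 \<le> l" "l \<le> L" "L + p < l + (N - c)" "l + (N - c) \<le> 2 * L + p"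
    have "h ((f ^^ (l + (N - c))) z) = (f ^^ (l + N)) z" using hz[of "l + (N - c)"] c(1) by simp
    also have "\<dots> = (f ^^ l) z" using z(2) by (simp add: funpow_add)
    finally show False using PQ[OF l] by blast
  qed
  then show ?thesis
  proof
    assume "c \<le> p"
    then show ?thesis using c(2) by (intro exI[of _ 0] conjI exI[of _ c]) auto
  next
    assume le: "N - c \<le> p"
    have "(f ^^ (N - c)) (h z) = (f ^^ (N - c + c)) z" using c(2) by (simp add: funpow_add)
    also have "\<dots> = z" using c(1) z(2) by simp
    finally show ?thesis using le by (intro exI[of _ "N - c"] conjI exI[of _ 0]) auto
  qed
qed

section \<open>Testing the candidate powers\<close>

text \<open>The order of the choices matters: \<open>\<delta>\<close> depends on the expansiveness constant, the distance
  of the two orbits and the modulus of continuity of \<open>h\<close>; it determines \<open>K\<close>, hence the list of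
  candidates and their windows; and only then is \<open>L\<close> taken longer than all that the itinerary
  contains beyond the two blocks and the gap between them.\<close>

lemma two_orbits_funpow_eq:
  fixes S :: "'a::metric_space set"
  assumes f: "bij_betw f S S" and comm: "\<And>x. x \<in> S \<Longrightarrow> h (f x) = f (h x)"
    and S: "compact S" and h: "continuous_on S h" "h ` S \<subseteq> S"
    and exp: "expansive_on S f" and glue: "periodic_gluing_orbit_on S f"
    and pres: "preserves_periodic_orbits S f h"
    and P: "P \<in> periodic_points S f" and Q: "Q \<in> periodic_points S f"
    and PQ: "Q \<notin> int_orbit S f P"
  shows "\<exists>a b. \<forall>x\<in>S. (f ^^ a) (h x) = (f ^^ b) x"
proof -
  have fS: "f ` S \<subseteq> S" using f by (simp add: bij_betw_def)
  obtain e where e: "e > 0" and far: "\<forall>x\<in>S. \<forall>y\<in>S. x \<noteq> y \<longrightarrow>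
      (\<exists>n::int. dist (int_iterate S f n x) (int_iterate S f n y) > e)"
    using exp unfolding expansive_on_def by blast
  have fin: "finite (int_orbit S f P)" "finite (int_orbit S f Q)"
    using finite_int_orbit_periodic[OF f] P Q by auto
  obtain r where r: "r > 0" "\<And>a b. \<lbrakk>a \<in> int_orbit S f P; b \<in> int_orbit S f Q\<rbrakk> \<Longrightarrow> dist a b \<ge> r"
  proof
    let ?D = "(\<lambda>(a, b). dist a b) ` (int_orbit S f P \<times> int_orbit S f Q)"
    have "P \<in> int_orbit S f P" "Q \<in> int_orbit S f Q"
      using funpow_in_int_orbit[of 0 f P S] funpow_in_int_orbit[of 0 f Q S] by simp_all
    then have D: "finite ?D" "?D \<noteq> {}" using fin by auto
    show "Min ?D > 0"
      using periodic_int_orbit_disjoint[OF f P Q PQ] by (subst Min_gr_iff[OF D]) auto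
    show "dist a b \<ge> Min ?D" if "a \<in> int_orbit S f P" "b \<in> int_orbit S f Q" for a b
      using that D by (intro Min_le) auto
  qed
  define \<rho> where "\<rho> = min e r / 2"
  have \<rho>: "\<rho> > 0" "2 * \<rho> \<le> e" "2 * \<rho> \<le> r" using e r by (auto simp: \<rho>_def)
  obtain d where d: "d > 0" "\<And>x y. \<lbrakk>x \<in> S; y \<in> S; dist x y < d\<rbrakk> \<Longrightarrow> dist (h x) (h y) < \<rho>"
    using compact_uniformly_continuous[OF h(1) S] \<rho>(1)
    unfolding uniformly_continuous_on_def by (metis dist_commute)
  define \<delta> where "\<delta> = min d \<rho>"
  have \<delta>: "\<delta> > 0" "\<delta> \<le> \<rho>" and unif: "\<And>x y. \<lbrakk>x \<in> S; y \<in> S; dist x y < \<delta>\<rbrakk> \<Longrightarrow> dist (h x) (h y) < \<rho>"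
    using d \<rho> by (auto simp: \<delta>_def)
  obtain K where K: "\<forall>(m::nat) (x :: nat \<Rightarrow> 'a) (n :: nat \<Rightarrow> nat).
        (\<forall>i\<le>m. x i \<in> S \<and> n i \<ge> 1) \<longrightarrow>
        (\<exists>(p :: nat \<Rightarrow> nat) z. z \<in> S \<and>
          (\<forall>i\<le>m. 1 \<le> p i \<and> p i \<le> K) \<and>
          (\<forall>i\<le>m. \<forall>l\<in>{1..n i}.
            dist ((f ^^ (l + (\<Sum>j<i. p j + n j))) z) ((f ^^ l) (x i)) < \<delta>) \<and>
          (f ^^ (\<Sum>j\<le>m. p j + n j)) z = z)"
    using glue \<delta>(1) unfolding periodic_gluing_orbit_on_def by blast
  show ?thesis
  proof (rule ccontr)
    assume none: "\<not> ?thesis"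
    have "\<exists>w\<in>S. dist ((f ^^ a) (h (f w))) ((f ^^ b) (f w)) > e" for a b
    proof (rule expansive_commuting_far[where u = "\<lambda>x. (f ^^ a) (h x)" and v = "f ^^ b", OF f far])
      show "(\<lambda>x. (f ^^ a) (h x)) ` S \<subseteq> S" "(f ^^ b) ` S \<subseteq> S" using funpow_in[OF fS] h(2) by blast+
      show "(f ^^ a) (h (f x)) = f ((f ^^ a) (h x))" if "x \<in> S" for x
        using comm[OF that] by (simp add: funpow_swap1)
      show "(f ^^ b) (f x) = f ((f ^^ b) x)" for x by (simp add: funpow_swap1)
      show "\<exists>x\<in>S. (f ^^ a) (h x) \<noteq> (f ^^ b) x" using none by blast
    qed
    then obtain w where w: "\<And>a b. w a b \<in> S"
      "\<And>a b. dist ((f ^^ a) (h (f (w a b)))) ((f ^^ b) (f (w a b))) > e" by metis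
    (* There are M candidates (a, b); block i + 2 tests the one encoded by i = a * (K + 1) + b.
       A window of length K + 1 suffices, as the relation is tested at times a + 1 and b + 1. *)
    define M where "M = (K + 1) * (K + 1)"
    (* All the windows, their gaps and the gap after the second block together are shorter than L. *)
    define L where "L = K + M * (2 * K + 1) + 1"
    define x where "x i = (if i = 0 then P else if i = 1 then Q
        else w ((i - 2) div (K + 1)) ((i - 2) mod (K + 1)))" for i
    define n where "n i = (if i < 2 then L else K + 1)" for i :: nat
    have xS: "\<forall>i\<le>M+1. x i \<in> S \<and> n i \<ge> 1"
      using w(1) P Q by (auto simp: x_def n_def L_def periodic_points_def)
    obtain p z where z: "z \<in> S" and p: "\<And>i. i \<le> M + 1 \<Longrightarrow> 1 \<le> p i \<and> p i \<le> K"
      and sh: "\<And>i l. \<lbrakk>i \<le> M + 1; 1 \<le> l; l \<le> n i\<rbrakk> \<Longrightarrow>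
            dist ((f ^^ (l + (\<Sum>j<i. p j + n j))) z) ((f ^^ l) (x i)) < \<delta>"
      and per: "(f ^^ (\<Sum>j\<le>M+1. p j + n j)) z = z"
      using K[THEN spec, THEN spec, THEN spec, THEN mp, OF xS] by force
    define N where "N = (\<Sum>j\<le>M+1. p j + n j)"
    define R where "R = (\<Sum>j<M. p (j + 2) + n (j + 2))"
    have "{..M+1} = {..<Suc (Suc M)}" by auto
    then have "N = (p 0 + n 0) + (p 1 + n 1) + R"
      unfolding N_def R_def by (simp only: sum.lessThan_Suc_shift) simp
    then have N: "N = p 0 + p 1 + 2 * L + R" by (simp add: n_def)
    have "R \<le> (\<Sum>j<M. 2 * K + 1)"
      unfolding R_def by (rule sum_mono) (use p in \<open>force simp: n_def\<close>)
    then have R: "R \<le> M * (2 * K + 1)" by simp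
    have "\<exists>a\<le>p 0. \<exists>b\<le>p 0. (f ^^ a) (h z) = (f ^^ b) z"
    proof (rule glued_orbit_shift[OF f comm pres P Q _ unif \<delta>(2) z])
      show "dist a b \<ge> 2 * \<rho>" if "a \<in> int_orbit S f P" "b \<in> int_orbit S f Q" for a b
        using r(2)[OF that] \<rho>(3) by simp
      show "(f ^^ N) z = z" using per by (simp add: N_def)
      show "dist ((f ^^ l) z) ((f ^^ l) P) < \<delta>" if "1 \<le> l" "l \<le> L" for l
        using sh[of 0 l] that by (simp add: x_def n_def)
      show "dist ((f ^^ (l + (p 0 + L))) z) ((f ^^ l) Q) < \<delta>" if "1 \<le> l" "l \<le> L" for l
        using sh[of 1 l] that by (simp add: x_def n_def)
      show "2 * L + p 0 \<le> N" using N by simp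
      have "p 1 \<le> K" using p[of 1] by simp
      then have "p 1 + R \<le> L" unfolding L_def using R by linarith
      then show "N \<le> 3 * L + p 0" using N by linarith
      show "L > 0" by (simp add: L_def)
    qed
    then obtain a b where ab: "a \<le> K" "b \<le> K" "(f ^^ a) (h z) = (f ^^ b) z"
      using p[of 0] by (meson le0 le_trans)
    define i where "i = a * (K + 1) + b"
    have "a * (K + 1) \<le> K * (K + 1)" using ab(1) by (rule mult_right_mono) simp
    then have i: "i + 2 \<le> M + 1" using ab(2) by (simp add: i_def M_def)
    have xi: "x (i + 2) = w a b"
      using ab(2) by (simp add: x_def i_def div_mult_self3 del: mult_Suc_right add_Suc_right)
    define v where "v = w a b"
    have vS: "v \<in> S" using w(1) by (simp add: v_def)
    define T where "T = (\<Sum>j<i+2. p j + n j)"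
    have near: "dist ((f ^^ (l + T)) z) ((f ^^ l) v) < \<delta>" if "1 \<le> l" "l \<le> K + 1" for l
      using sh[OF i that(1)] that(2) xi unfolding T_def v_def n_def by simp
    have *: "(f ^^ a) (h (f y)) = h ((f ^^ (a + 1)) y)" if "y \<in> S" for y
    proof -
      have "f y \<in> S" using f that by (auto simp: bij_betw_def)
      then have "h ((f ^^ a) (f y)) = (f ^^ a) (h (f y))" using funpow_commute_on[of f S h, OF fS comm] by blast
      then show ?thesis by (simp add: funpow_swap1)
    qed
    let ?y = "(f ^^ T) z"
    have yS: "?y \<in> S" using funpow_in[OF fS z] .
    have "(f ^^ a) (h (f ?y)) = (f ^^ b) (f ?y)"
    proof -
      have "(f ^^ a) (h ((f ^^ (T + 1)) z)) = (f ^^ (T + 1)) ((f ^^ a) (h z))"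
        using funpow_commute_on[of f S h, OF fS comm z, of "T + 1"]
        by (metis add.commute comp_apply funpow_add)
      also have "\<dots> = (f ^^ b) ((f ^^ (T + 1)) z)"
        using ab(3) by (metis add.commute comp_apply funpow_add)
      finally show ?thesis by simp
    qed
    then have eq: "h ((f ^^ (a + 1 + T)) z) = (f ^^ (b + 1 + T)) z"
      using *[OF yS] by (simp add: funpow_add funpow_swap1)
    (* Shadowing transfers this relation to the window point v, where it fails by more than e. *)
    have "dist (h ((f ^^ (a + 1 + T)) z)) (h ((f ^^ (a + 1)) v)) < \<rho>"
      by (rule unif[OF funpow_in[OF fS z] funpow_in[OF fS vS] near]) (use ab(1) in simp_all)
    moreover have "dist ((f ^^ (b + 1 + T)) z) ((f ^^ (b + 1)) v) < \<rho>"
      using near[of "b + 1"] ab(2) \<delta>(2) by simp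
    ultimately have "dist (h ((f ^^ (a + 1)) v)) ((f ^^ (b + 1)) v) < e"
      using dist_triangle_less_add[of "h ((f ^^ (a + 1)) v)" "(f ^^ (b + 1 + T)) z" \<rho> "(f ^^ (b + 1)) v" \<rho>]
        \<rho>(2) eq by (simp add: dist_commute)
    moreover have "dist (h ((f ^^ (a + 1)) v)) ((f ^^ (b + 1)) v) > e"
      using w(2)[of a b] *[OF vS] unfolding v_def[symmetric] by (simp add: funpow_swap1)
    ultimately show False by simp
  qed
qed

theorem theorem1:
  fixes \<Lambda> :: "'a::metric_space set" and f h :: "'a \<Rightarrow> 'a"
  assumes "compact \<Lambda>"
    and "\<exists>f'. homeomorphism \<Lambda> \<Lambda> f f'"
    and "expansive_on \<Lambda> f"
    and "periodic_gluing_orbit_on \<Lambda> f"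
    and "\<exists>h'. homeomorphism \<Lambda> \<Lambda> h h'"
    and "\<forall>x\<in>\<Lambda>. h (f x) = f (h x)"
    and "preserves_periodic_orbits \<Lambda> f h"
  shows "\<exists>k::int. \<forall>x\<in>\<Lambda>. h x = int_iterate \<Lambda> f k x"
proof -
  obtain f' where "homeomorphism \<Lambda> \<Lambda> f f'" using assms(2) by blast
  then have f: "bij_betw f \<Lambda> \<Lambda>"
    unfolding homeomorphism_def by (auto intro!: bij_betw_byWitness[where f' = f'])
  then have f\<Lambda>: "f ` \<Lambda> \<subseteq> \<Lambda>" by (simp add: bij_betw_def)
  have h: "continuous_on \<Lambda> h" "h ` \<Lambda> \<subseteq> \<Lambda>"
    using assms(5) unfolding homeomorphism_def by auto
  have comm: "\<And>x. x \<in> \<Lambda> \<Longrightarrow> h (f x) = f (h x)" using assms(6) by blast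
  note glue = assms(4)
  show ?thesis
  proof (cases "\<exists>P\<in>periodic_points \<Lambda> f. \<exists>Q\<in>periodic_points \<Lambda> f. Q \<notin> int_orbit \<Lambda> f P")
    case True
    then obtain a b where "\<forall>x\<in>\<Lambda>. (f ^^ a) (h x) = (f ^^ b) x"
      using two_orbits_funpow_eq[OF f comm assms(1) h assms(3) glue assms(7)] by blast
    then show ?thesis using eq_int_iterate_of_funpow_eq[OF f] h(2) by (metis image_subset_iff)
  next
    case single: False
    show ?thesis
    proof (cases "\<Lambda> = {}")
      case False
      then obtain P where P: "P \<in> periodic_points \<Lambda> f"
        using periodic_points_dense[OF f glue, of _ 1] by force
      then obtain N where N: "N \<ge> 1" "(f ^^ N) P = P" and P\<Lambda>: "P \<in> \<Lambda>"
        by (auto simp: periodic_points_def)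
      note orbit = int_orbit_periodic[OF f P\<Lambda> N]
      obtain c where c: "h P = (f ^^ c) P"
        using preserves_periodic_orbitsD[OF assms(7) P, of 0] orbit by auto
      have "h x = int_iterate \<Lambda> f (int c) x" if x: "x \<in> \<Lambda>" for x
      proof -
        have "x \<in> int_orbit \<Lambda> f P" using single_periodic_orbit[OF f glue P] single P x by blast
        then obtain l where l: "x = (f ^^ l) P" using orbit by blast
        have "h x = (f ^^ l) ((f ^^ c) P)"
          using funpow_commute_on[of f \<Lambda> h P l, OF f\<Lambda> comm P\<Lambda>] l c by simp
        also have "\<dots> = (f ^^ c) x" using l by (metis add.commute comp_apply funpow_add)
        finally show ?thesis by (simp add: int_iterate_def)
      qed
      then show ?thesis by blast
    qed simp
  qed
qed

end
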